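(* Let $\Omega$, $K_1,K_2,K_3$, $(\mathbf{n}_k,\lambda_k)$, $\mathcal{T}_h$, $V_h$, $\Pi_h$, $a$ and $b$ be as in the context. Then the bilinear forms $a$ on $V_h\times V_h$ and $b$ on $V_h\times\Pi_h$ are continuous; that is, there exist constants $C_A,C_B>0$ such that $$|a(\mathbf{u},\mathbf{v})|\le C_A\|\mathbf{u}\|_{DC}\|\mathbf{v}\|_{DC},\qquad|b(\mathbf{v},\gamma)|\le C_B\|\mathbf{v}\|_{DC}\|\gamma\|_0$$ for all $\mathbf{u},\mathbf{v}\in V_h$ and $\gamma\in\Pi_h$.
   Context: $\Omega$ is an open bounded domain in $\mathbb{R}^N$, $N\in\{2,3\}$ (for $N=2$ vector fields still have three components, independent of $z$), which is a convex polyhedron or has a $C^{1,1}$ boundary. $(\cdot,\cdot)$, $|\cdot|$ are the Euclidean inner product and norm; $\langle\cdot,\cdot\rangle_0$, $\|\cdot\|_0$ the $L^2$ ones; $\|\mathbf{v}\|_{DC}^2=\|\mathbf{v}\|_0^2+\|\nabla\cdot\mathbf{v}\|_0^2+\|\nabla\times\mathbf{v}\|_0^2$. $\{\mathcal{T}_h\}$, $0<h\le1$, is a family of quadrilateral (hexahedral if $N=3$) subdivisions of $\Omega$ with $\max\{\mathrm{diam}\,T:T\in\mathcal{T}_h\}\le h\,\mathrm{diam}\,\Omega$, and there is $\rho>0$ with $\min\{\mathrm{diam}\,B_T:T\in\mathcal{T}_h\}\ge\rho\,h\,\mathrm{diam}\,\Omega$ for all $h$, where $B_T$ is the largest ball contained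 in $T$ such that $T$ is star-shaped with respect to $B_T$. $Q_p$ denotes continuous piecewise polynomials of degree $p\ge1$ on $\mathcal{T}_h$, $P_0$ the piecewise constants. $b_T$ is the quadratic bubble function on $T\in\mathcal{T}_h$, vanishing on $\partial T$, positive inside $T$, with $\int_Tb_T\,dV=1$. Fix $m\ge1$; $V_h^b=\{\mathbf{v}\text{ continuous on }\overline\Omega\text{ with values in }\mathbb{R}^3,\ \mathbf{v}=\mathbf{0}\text{ on }\partial\Omega:\ \mathbf{v}|_T=a_Tb_T\mathbf{n}_k|_T\ \forall T\in\mathcal{T}_h,\ a_T\in\mathbb{R}\}$, $\Pi_h=P_0$, $V_h=\{\mathbf{v}\in Q_m\times Q_m\times Q_m\oplus V_h^b:\mathbf{v}=\mathbf{0}\text{ on }\partial\Omega\}$. $K_1\ge0$, $K_2,K_3>0$, $\kappa=K_2/K_3$. The current iterates are $\mathbf{n}_k\in Q_p\times Q_p\times Q_p$ for some $p\ge1$ and $\lambda_k\in P_0$, with $\alpha\le|\mathbf{n}_k|^2\le\beta$ on $\Omega$ for constants $0<\alpha\le1\le\beta$, such that $\mathbf{Z}(\mathbf{n}_k)=\mathbf{I}-(1-\kappa)\mathbf{n}_k\otimes\mathbf{n}_k$ is uniformly symmetric positive definite: $\eta|\xi|^2\le\xi^T\mathbf{Z}(\mathbf{n}_k(\mathbf{x}))\xi\le\Lambda|\xi|^2$ for all $\mathbf{x}\in\Omega$, $\xi\in\mathbb{R}^3$, with $0<\eta\le\Lambda$. The forms are $a(\mathbf{u},\mathbf{v})=K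_1\langle\nabla\cdot\mathbf{u},\nabla\cdot\mathbf{v}\rangle_0+K_3\langle\mathbf{Z}(\mathbf{n}_k)\nabla\times\mathbf{u},\nabla\times\mathbf{v}\rangle_0+(K_2-K_3)\big(\langle\mathbf{u}\cdot\nabla\times\mathbf{v},\mathbf{n}_k\cdot\nabla\times\mathbf{n}_k\rangle_0+\langle\mathbf{n}_k\cdot\nabla\times\mathbf{v},\mathbf{u}\cdot\nabla\times\mathbf{n}_k\rangle_0+\langle\mathbf{n}_k\cdot\nabla\times\mathbf{n}_k,\mathbf{v}\cdot\nabla\times\mathbf{u}\rangle_0+\langle\mathbf{n}_k\cdot\nabla\times\mathbf{u},\mathbf{v}\cdot\nabla\times\mathbf{n}_k\rangle_0+\langle\mathbf{u}\cdot\nabla\times\mathbf{n}_k,\mathbf{v}\cdot\nabla\times\mathbf{n}_k\rangle_0\big)+\int_\Omega\lambda_k(\mathbf{u},\mathbf{v})\,dV$ and $b(\mathbf{v},\gamma)=\int_\Omega\gamma(\mathbf{n}_k,\mathbf{v})\,dV$. *)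

theory Defs
  imports "HOL-Analysis.Analysis"
begin

section \<open>The domain\<close>

text \<open>
  Near every boundary point the domain is the region above the graph of a function
  with Lipschitz gradient. The graph is taken over the hyperplane orthogonal to a unit
  vector \<open>\<nu>\<close>, and \<open>\<gamma>\<close> is only evaluated on that hyperplane.
\<close>

definition C11_boundary :: "(real^'n) set \<Rightarrow> bool" where
  "C11_boundary \<Omega> \<longleftrightarrow>
     (\<forall>x0 \<in> frontier \<Omega>. \<exists>\<nu> r \<gamma> g L. norm \<nu> = 1 \<and> r > 0 \<and>
        (\<forall>x. (\<gamma> has_derivative (\<lambda>w. g x \<bullet> w)) (at x)) \<and> L-lipschitz_on UNIV g \<and>
        \<Omega> \<inter> ball x0 r = {x \<in> ball x0 r. \<gamma> (x - (x \<bullet> \<nu>) *\<^sub>R \<nu>) < x \<bullet> \<nu>})"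

definition admissible_domain :: "(real^'n) set \<Rightarrow> bool" where
  "admissible_domain \<Omega> \<longleftrightarrow> \<Omega> \<noteq> {} \<and> open \<Omega> \<and> bounded \<Omega> \<and> connected \<Omega> \<and>
     ((convex \<Omega> \<and> polyhedron (closure \<Omega>)) \<or> C11_boundary \<Omega>)"


section \<open>Differential operators and norms\<close>

text \<open>
  Fields on a domain in \<open>real^'n\<close> have three components. The map \<open>e\<close> says which of the
  coordinates \<open>1, 2, 3\<close> of physical space each coordinate of \<open>real^'n\<close> is. For a
  two-dimensional domain \<open>range e = {1, 2}\<close>, and the derivative with respect to the
  missing third coordinate is zero.

  Derivatives are classical pointwise derivatives. They are applied to continuous
  piecewise \<open>C\<^sup>1\<close> fields, for which they exist off the null set of cell boundaries
  and represent the weak derivatives. All integrals are with respect to \<open>lebesgue\<close>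
  (rather than \<open>lborel\<close>), so the unspecified values on that null set do not matter.
\<close>

definition partial_deriv :: "('n::finite \<Rightarrow> 3) \<Rightarrow> 3 \<Rightarrow> (real^'n \<Rightarrow> real) \<Rightarrow> real^'n \<Rightarrow> real" where
  "partial_deriv e j f x =
     (if j \<in> range e then frechet_derivative f (at x) (axis (inv e j) 1) else 0)"

definition divergence :: "('n::finite \<Rightarrow> 3) \<Rightarrow> (real^'n \<Rightarrow> real^3) \<Rightarrow> real^'n \<Rightarrow> real" where
  "divergence e v x = (\<Sum>j\<in>UNIV. partial_deriv e j (\<lambda>y. v y $ j) x)"

definition curl :: "('n::finite \<Rightarrow> 3) \<Rightarrow> (real^'n \<Rightarrow> real^3) \<Rightarrow> real^'n \<Rightarrow> real^3" where
  "curl e v x = vector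
     [partial_deriv e 2 (\<lambda>y. v y $ 3) x - partial_deriv e 3 (\<lambda>y. v y $ 2) x,
      partial_deriv e 3 (\<lambda>y. v y $ 1) x - partial_deriv e 1 (\<lambda>y. v y $ 3) x,
      partial_deriv e 1 (\<lambda>y. v y $ 2) x - partial_deriv e 2 (\<lambda>y. v y $ 1) x]"

definition L2_inner ::
    "(real^'n) set \<Rightarrow> (real^'n \<Rightarrow> 'b::real_inner) \<Rightarrow> (real^'n \<Rightarrow> 'b) \<Rightarrow> real" where
  "L2_inner \<Omega> f g = (LINT x:\<Omega>|lebesgue. f x \<bullet> g x)"

definition L2_norm :: "(real^'n) set \<Rightarrow> (real^'n \<Rightarrow> 'b::real_inner) \<Rightarrow> real" where
  "L2_norm \<Omega> f = sqrt (L2_inner \<Omega> f f)"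

definition DC_norm :: "('n::finite \<Rightarrow> 3) \<Rightarrow> (real^'n) set \<Rightarrow> (real^'n \<Rightarrow> real^3) \<Rightarrow> real" where
  "DC_norm e \<Omega> v =
     sqrt ((L2_norm \<Omega> v)\<^sup>2 + (L2_norm \<Omega> (divergence e v))\<^sup>2 + (L2_norm \<Omega> (curl e v))\<^sup>2)"


section \<open>Quadrilateral and hexahedral subdivisions\<close>

definition ref_cube :: "(real^'n) set" where
  "ref_cube = cbox 0 1"

text \<open>
  A cell is a closed set together with a \<open>C\<^sup>1\<close> diffeomorphism from the unit square or
  cube onto it. For straight-sided quadrilaterals and hexahedra this is the usual
  multilinear map; more general maps are admitted because cells touching a \<open>C^{1,1}\<close>
  boundary must be curved.
\<close>

definition reference_map :: "(real^'n \<Rightarrow> real^'n) \<Rightarrow> (real^'n) set \<Rightarrow> bool" where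
  "reference_map \<Phi> T \<longleftrightarrow> \<Phi> ` ref_cube = T \<and> inj_on \<Phi> ref_cube \<and>
     (\<exists>J :: real^'n \<Rightarrow> real^'n^'n. continuous_on ref_cube J \<and>
        (\<forall>\<xi>\<in>ref_cube. (\<Phi> has_derivative (\<lambda>w. J \<xi> *v w)) (at \<xi> within ref_cube) \<and>
                      det (J \<xi>) \<noteq> 0))"

definition quad_subdivision ::
    "(real^'n) set \<Rightarrow> (real^'n) set set \<Rightarrow> ((real^'n) set \<Rightarrow> real^'n \<Rightarrow> real^'n) \<Rightarrow> bool" where
  "quad_subdivision \<Omega> \<T> F \<longleftrightarrow> finite \<T> \<and> \<Union>\<T> = closure \<Omega> \<and>
     pairwise (\<lambda>S T. interior S \<inter> interior T = {}) \<T> \<and>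
     (\<forall>T\<in>\<T>. reference_map (F T) T)"

definition star_shaped_wrt :: "(real^'n) set \<Rightarrow> (real^'n) set \<Rightarrow> bool" where
  "star_shaped_wrt T B \<longleftrightarrow> (\<forall>x\<in>T. convex hull (insert x B) \<subseteq> T)"

definition largest_star_ball :: "(real^'n) set \<Rightarrow> (real^'n) set \<Rightarrow> bool" where
  "largest_star_ball T B \<longleftrightarrow>
     (\<exists>c r. r > 0 \<and> B = cball c r \<and> B \<subseteq> T \<and> star_shaped_wrt T B \<and>
        (\<forall>c' r'. cball c' r' \<subseteq> T \<and> star_shaped_wrt T (cball c' r') \<longrightarrow> r' \<le> r))"

definition quasi_uniform_family ::
    "(real^'n) set \<Rightarrow> (real \<Rightarrow> (real^'n) set set) \<Rightarrow>
      (real \<Rightarrow> (real^'n) set \<Rightarrow> real^'n \<Rightarrow> real^'n) \<Rightarrow> bool" where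
  "quasi_uniform_family \<Omega> \<T> F \<longleftrightarrow>
     (\<forall>h\<in>{0<..1}. quad_subdivision \<Omega> (\<T> h) (F h) \<and>
        (\<forall>T\<in>\<T> h. diameter T \<le> h * diameter \<Omega>)) \<and>
     (\<exists>\<rho>>0. \<forall>h\<in>{0<..1}. \<forall>T\<in>\<T> h. \<exists>B. largest_star_ball T B \<and>
        diameter B \<ge> \<rho> * h * diameter \<Omega>)"


section \<open>Finite element spaces\<close>

text \<open>
  As usual on quadrilaterals and hexahedra, degree \<open>p\<close> means degree at most \<open>p\<close> in each
  reference coordinate, and the functions on a cell are the images of such polynomials
  under the reference map. Elements of the spaces are total functions whose values
  outside \<open>closure \<Omega>\<close> are irrelevant.
\<close>

definition tensor_polys :: "nat \<Rightarrow> (real^'n \<Rightarrow> real) set" where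
  "tensor_polys p =
     {q. \<exists>c. \<forall>\<xi>. q \<xi> = (\<Sum>k | \<forall>i. k i \<le> p. c k * (\<Prod>i\<in>UNIV. (\<xi> $ i) ^ k i))}"

definition cell_polys ::
    "nat \<Rightarrow> (real^'n \<Rightarrow> real^'n) \<Rightarrow> (real^'n \<Rightarrow> real) set" where
  "cell_polys p \<Phi> = {f. \<exists>q\<in>tensor_polys p. \<forall>\<xi>\<in>ref_cube. f (\<Phi> \<xi>) = q \<xi>}"

definition Q_space ::
    "(real^'n) set \<Rightarrow> (real^'n) set set \<Rightarrow> ((real^'n) set \<Rightarrow> real^'n \<Rightarrow> real^'n) \<Rightarrow>
      nat \<Rightarrow> (real^'n \<Rightarrow> real) set" where
  "Q_space \<Omega> \<T> F p = {f. continuous_on (closure \<Omega>) f \<and> (\<forall>T\<in>\<T>. f \<in> cell_polys p (F T))}"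

definition Q_vec_space ::
    "(real^'n) set \<Rightarrow> (real^'n) set set \<Rightarrow> ((real^'n) set \<Rightarrow> real^'n \<Rightarrow> real^'n) \<Rightarrow>
      nat \<Rightarrow> (real^'n \<Rightarrow> real^3) set" where
  "Q_vec_space \<Omega> \<T> F p = {v. \<forall>i. (\<lambda>x. v x $ i) \<in> Q_space \<Omega> \<T> F p}"

definition P0_space :: "(real^'n) set set \<Rightarrow> (real^'n \<Rightarrow> real) set" where
  "P0_space \<T> = {f. \<forall>T\<in>\<T>. \<exists>c. \<forall>x\<in>interior T. f x = c}"

definition quadratic_bubble ::
    "(real^'n) set \<Rightarrow> (real^'n \<Rightarrow> real^'n) \<Rightarrow> (real^'n \<Rightarrow> real) \<Rightarrow> bool" where
  "quadratic_bubble T \<Phi> b \<longleftrightarrow> b \<in> cell_polys 2 \<Phi> \<and>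
     (\<forall>x\<in>frontier T. b x = 0) \<and> (\<forall>x\<in>interior T. b x > 0) \<and> (LINT x:T|lebesgue. b x) = 1"

definition bubble_space ::
    "(real^'n) set \<Rightarrow> (real^'n) set set \<Rightarrow> ((real^'n) set \<Rightarrow> real^'n \<Rightarrow> real) \<Rightarrow>
      (real^'n \<Rightarrow> real^3) \<Rightarrow> (real^'n \<Rightarrow> real^3) set" where
  "bubble_space \<Omega> \<T> b n =
     {v. continuous_on (closure \<Omega>) v \<and> (\<forall>x\<in>frontier \<Omega>. v x = 0) \<and>
         (\<forall>T\<in>\<T>. \<exists>a. \<forall>x\<in>T. v x = (a * b T x) *\<^sub>R n x)}"

definition V_space ::
    "(real^'n) set \<Rightarrow> (real^'n) set set \<Rightarrow> ((real^'n) set \<Rightarrow> real^'n \<Rightarrow> real^'n) \<Rightarrow>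
      ((real^'n) set \<Rightarrow> real^'n \<Rightarrow> real) \<Rightarrow> nat \<Rightarrow> (real^'n \<Rightarrow> real^3) \<Rightarrow>
      (real^'n \<Rightarrow> real^3) set" where
  "V_space \<Omega> \<T> F b m n =
     {v. (\<exists>w\<in>Q_vec_space \<Omega> \<T> F m. \<exists>z\<in>bubble_space \<Omega> \<T> b n. v = (\<lambda>x. w x + z x)) \<and>
         (\<forall>x\<in>frontier \<Omega>. v x = 0)}"


section \<open>The bilinear forms\<close>

definition Z_tensor :: "real \<Rightarrow> real^3 \<Rightarrow> real^3^3" where
  "Z_tensor \<kappa> n = mat 1 - (1 - \<kappa>) *\<^sub>R (\<chi> i j. n $ i * n $ j)"

definition form_a ::
    "('n::finite \<Rightarrow> 3) \<Rightarrow> (real^'n) set \<Rightarrow> real \<Rightarrow> real \<Rightarrow> real \<Rightarrow>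
      (real^'n \<Rightarrow> real^3) \<Rightarrow> (real^'n \<Rightarrow> real) \<Rightarrow>
      (real^'n \<Rightarrow> real^3) \<Rightarrow> (real^'n \<Rightarrow> real^3) \<Rightarrow> real" where
  "form_a e \<Omega> K1 K2 K3 n lam u v =
     K1 * L2_inner \<Omega> (divergence e u) (divergence e v)
     + K3 * L2_inner \<Omega> (\<lambda>x. Z_tensor (K2 / K3) (n x) *v curl e u x) (curl e v)
     + (K2 - K3) *
        (L2_inner \<Omega> (\<lambda>x. u x \<bullet> curl e v x) (\<lambda>x. n x \<bullet> curl e n x)
         + L2_inner \<Omega> (\<lambda>x. n x \<bullet> curl e v x) (\<lambda>x. u x \<bullet> curl e n x)
         + L2_inner \<Omega> (\<lambda>x. n x \<bullet> curl e n x) (\<lambda>x. v x \<bullet> curl e u x)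
         + L2_inner \<Omega> (\<lambda>x. n x \<bullet> curl e u x) (\<lambda>x. v x \<bullet> curl e n x)
         + L2_inner \<Omega> (\<lambda>x. u x \<bullet> curl e n x) (\<lambda>x. v x \<bullet> curl e n x))
     + (LINT x:\<Omega>|lebesgue. lam x * (u x \<bullet> v x))"

definition form_b ::
    "(real^'n) set \<Rightarrow> (real^'n \<Rightarrow> real^3) \<Rightarrow> (real^'n \<Rightarrow> real^3) \<Rightarrow> (real^'n \<Rightarrow> real) \<Rightarrow> real" where
  "form_b \<Omega> n v \<gamma> = (LINT x:\<Omega>|lebesgue. \<gamma> x * (n x \<bullet> v x))"

end

theory Submission
  imports Defs
begin

text \<open>
  Both forms are sums of integrals over \<open>\<Omega>\<close> whose integrands are products of one factor built
  from \<open>u\<close> (the field, its divergence or its curl), one such factor built from \<open>v\<close> (or the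
  multiplier \<open>\<gamma>\<close>), and coefficients built from \<open>n\<close>, \<open>curl e n\<close> and \<open>lam\<close>. Once the coefficients are
  bounded almost everywhere, the Cauchy-Schwarz inequality bounds each term by a constant times
  two \<open>L\<^sup>2\<close> norms (\<open>abs_set_integral_le_L2_norms\<close>), and each of these \<open>L\<^sup>2\<close> norms, except that of
  \<open>\<gamma>\<close>, is at most the corresponding \<open>DC_norm\<close>. The director is bounded by hypothesis. The tensor
  \<open>Z_tensor\<close> is the identity plus a multiple of \<open>n \<otimes> n\<close> and therefore bounded as well.

  What has to be proved about the finite element spaces is that \<open>curl e n\<close> and \<open>lam\<close> are bounded
  almost everywhere, and that the fields and their derivatives are measurable and square
  integrable. Both follow from regularity on each cell. A function in \<open>cell_polys\<close> is a polynomial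
  composed with the inverse of a \<open>C\<^sup>1\<close> diffeomorphism whose derivative is continuous and
  invertible up to the boundary, so its own derivative extends continuously to the compact cell
  (\<open>C1_up_to_boundary_cell_poly\<close>). Products with bubble functions and sums keep this property, and
  so all elements of \<open>V_space\<close> have it. Since the cell boundaries are null sets
  (\<open>reference_map_negligible_frontier\<close>) and there are finitely many cells, functions that are
  continuous on each cell are measurable and bounded almost everywhere on \<open>\<Omega>\<close>
  (\<open>piecewise_continuous_imp_bounded_measurable_on\<close>).
\<close>

section \<open>Square-integrable bounds\<close>

definition bounded_measurable_on :: "(real^'n) set \<Rightarrow> (real^'n \<Rightarrow> 'b::euclidean_space) \<Rightarrow> bool" where
  "bounded_measurable_on \<Omega> f \<longleftrightarrow> set_borel_measurable lebesgue \<Omega> f \<and>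
     (\<exists>M. AE x in lebesgue. x \<in> \<Omega> \<longrightarrow> norm (f x) \<le> M)"

lemma L2_inner_self_nonneg: "L2_inner \<Omega> f f \<ge> 0"
  unfolding L2_inner_def set_lebesgue_integral_def by (intro integral_nonneg_AE) auto

lemma L2_norm_nonneg [simp]: "L2_norm \<Omega> f \<ge> 0"
  by (simp add: L2_norm_def L2_inner_self_nonneg)

lemma bounded_measurable_on_nn_integral_square:
  fixes f :: "real^'n \<Rightarrow> 'b::euclidean_space"
  assumes \<Omega>: "\<Omega> \<in> lmeasurable" and f: "bounded_measurable_on \<Omega> f"
  shows "(\<integral>\<^sup>+x. (ennreal (norm (indicat_real \<Omega> x *\<^sub>R f x)))\<^sup>2 \<partial>lebesgue) = ennreal ((L2_norm \<Omega> f)\<^sup>2)"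
proof -
  let ?F = "\<lambda>x. indicat_real \<Omega> x *\<^sub>R f x"
  obtain M where M: "AE x in lebesgue. x \<in> \<Omega> \<longrightarrow> norm (f x) \<le> M"
    using f by (auto simp: bounded_measurable_on_def)
  have meas [measurable]: "?F \<in> borel_measurable lebesgue"
    using f by (auto simp: bounded_measurable_on_def set_borel_measurable_def)
  have int: "integrable lebesgue (\<lambda>x. (norm (?F x))\<^sup>2)"
  proof (rule integrableI_bounded_set[where A=\<Omega> and B="M\<^sup>2"])
    show "\<Omega> \<in> sets lebesgue" using \<Omega> by auto
    show "(\<lambda>x. (norm (?F x))\<^sup>2) \<in> borel_measurable lebesgue" by measurable
    show "emeasure lebesgue \<Omega> < \<infinity>" using \<Omega> by (auto simp: fmeasurable_def)
    show "AE x\<in>\<Omega> in lebesgue. norm ((norm (?F x))\<^sup>2) \<le> M\<^sup>2"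
      using M by eventually_elim (auto intro: power_mono)
  qed auto
  have "(\<integral>\<^sup>+x. (ennreal (norm (?F x)))\<^sup>2 \<partial>lebesgue) = (\<integral>\<^sup>+x. ennreal ((norm (?F x))\<^sup>2) \<partial>lebesgue)"
    by (simp add: ennreal_power)
  also have "\<dots> = ennreal (\<integral>x. (norm (?F x))\<^sup>2 \<partial>lebesgue)"
    using int by (intro nn_integral_eq_integral) auto
  also have "(\<integral>x. (norm (?F x))\<^sup>2 \<partial>lebesgue) = L2_inner \<Omega> f f"
    unfolding L2_inner_def set_lebesgue_integral_def
    by (intro Bochner_Integration.integral_cong)
       (auto simp: power2_norm_eq_inner indicator_def)
  also have "L2_inner \<Omega> f f = (L2_norm \<Omega> f)\<^sup>2"
    by (simp add: L2_norm_def L2_inner_self_nonneg)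
  finally show ?thesis .
qed

text \<open>
  Every term of the two forms is estimated by this consequence of the Cauchy-Schwarz
  inequality. If \<open>h\<close> is not integrable, its Bochner integral is zero by convention, so
  measurability matters only for the two factors, whose norms would otherwise be meaningless.
\<close>

lemma abs_set_integral_le_L2_norms:
  fixes f :: "real^'n \<Rightarrow> 'b::euclidean_space" and g :: "real^'n \<Rightarrow> 'c::euclidean_space"
    and h :: "real^'n \<Rightarrow> real"
  assumes \<Omega>: "\<Omega> \<in> lmeasurable"
    and f: "bounded_measurable_on \<Omega> f" and g: "bounded_measurable_on \<Omega> g"
    and M: "0 \<le> M"
    and h: "AE x in lebesgue. x \<in> \<Omega> \<longrightarrow> \<bar>h x\<bar> \<le> M * (norm (f x) * norm (g x))"
  shows "\<bar>LINT x:\<Omega>|lebesgue. h x\<bar> \<le> M * (L2_norm \<Omega> f * L2_norm \<Omega> g)"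
proof (cases "set_integrable lebesgue \<Omega> h")
  case False
  then show ?thesis
    using M by (simp add: set_lebesgue_integral_def set_integrable_def not_integrable_integral_eq)
next
  case True
  let ?F = "\<lambda>x. ennreal (norm (indicat_real \<Omega> x *\<^sub>R f x))"
  let ?G = "\<lambda>x. ennreal (norm (indicat_real \<Omega> x *\<^sub>R g x))"
  have [measurable]: "(\<lambda>x. indicat_real \<Omega> x *\<^sub>R f x) \<in> borel_measurable lebesgue"
       "(\<lambda>x. indicat_real \<Omega> x *\<^sub>R g x) \<in> borel_measurable lebesgue"
    using f g by (auto simp: bounded_measurable_on_def set_borel_measurable_def)
  let ?I = "\<integral>\<^sup>+x. ?F x * ?G x \<partial>lebesgue"
  have "?I\<^sup>2 \<le> (\<integral>\<^sup>+x. (?F x)\<^sup>2 \<partial>lebesgue) * (\<integral>\<^sup>+x. (?G x)\<^sup>2 \<partial>lebesgue)"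
    by (intro Cauchy_Schwarz_nn_integral) measurable
  also have "\<dots> = ennreal ((L2_norm \<Omega> f * L2_norm \<Omega> g)\<^sup>2)"
    using bounded_measurable_on_nn_integral_square[OF \<Omega> f]
      bounded_measurable_on_nn_integral_square[OF \<Omega> g]
    by (simp add: ennreal_mult' power_mult_distrib)
  finally have CS2: "?I\<^sup>2 \<le> ennreal ((L2_norm \<Omega> f * L2_norm \<Omega> g)\<^sup>2)" .
  have CS: "?I \<le> ennreal (L2_norm \<Omega> f * L2_norm \<Omega> g)"
  proof (cases "?I")
    case (real r)
    then have "r\<^sup>2 \<le> (L2_norm \<Omega> f * L2_norm \<Omega> g)\<^sup>2"
      using CS2 by (simp add: ennreal_power)
    then have "r \<le> L2_norm \<Omega> f * L2_norm \<Omega> g"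
      by (rule power2_le_imp_le) simp
    then show ?thesis using real by (simp add: ennreal_leI)
  next
    case top
    then show ?thesis using CS2 by (simp add: power2_eq_square top_unique)
  qed
  have "ennreal (norm (LINT x:\<Omega>|lebesgue. h x)) \<le> (\<integral>\<^sup>+x. norm (indicat_real \<Omega> x *\<^sub>R h x) \<partial>lebesgue)"
    using True unfolding set_lebesgue_integral_def set_integrable_def
    by (rule integral_norm_bound_ennreal)
  also have "\<dots> \<le> (\<integral>\<^sup>+x. ennreal M * (?F x * ?G x) \<partial>lebesgue)"
  proof (rule nn_integral_mono_AE, use h in eventually_elim)
    case (elim x)
    then show ?case
      using M by (auto simp: indicator_def ennreal_mult'[symmetric] intro!: ennreal_leI)
  qed
  also have "\<dots> = ennreal M * ?I"
    by (intro nn_integral_cmult) measurable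
  also have "\<dots> \<le> ennreal M * ennreal (L2_norm \<Omega> f * L2_norm \<Omega> g)"
    by (intro mult_left_mono CS) auto
  also have "\<dots> = ennreal (M * (L2_norm \<Omega> f * L2_norm \<Omega> g))"
    using M by (simp add: ennreal_mult')
  finally show ?thesis
    using M by (simp add: ennreal_le_iff)
qed

lemma L2_norm_le_DC_norm:
  "L2_norm \<Omega> v \<le> DC_norm e \<Omega> v"
  "L2_norm \<Omega> (divergence e v) \<le> DC_norm e \<Omega> v"
  "L2_norm \<Omega> (curl e v) \<le> DC_norm e \<Omega> v"
  unfolding DC_norm_def by (auto intro!: real_le_rsqrt)


section \<open>Functions that are continuous on each cell\<close>

text \<open>
  The values on the cell boundaries are left free, because classical derivatives of finite
  element functions are only controlled in the interiors of the cells.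
\<close>

definition piecewise_continuous ::
    "(real^'n) set set \<Rightarrow> (real^'n \<Rightarrow> 'b::euclidean_space) \<Rightarrow> bool" where
  "piecewise_continuous \<T> f \<longleftrightarrow>
     (\<forall>T\<in>\<T>. \<exists>g. continuous_on T g \<and> (\<forall>x\<in>interior T. f x = g x))"

lemma piecewise_continuous_imp_bounded_measurable_on:
  fixes f :: "real^'n \<Rightarrow> 'b::euclidean_space"
  assumes fin: "finite \<T>" and cover: "\<Omega> \<subseteq> \<Union>\<T>" and opn: "open \<Omega>"
    and cell: "\<And>T. T \<in> \<T> \<Longrightarrow> compact T" "\<And>T. T \<in> \<T> \<Longrightarrow> negligible (frontier T)"
    and f: "piecewise_continuous \<T> f"
  shows "bounded_measurable_on \<Omega> f"
proof -
  obtain g where g: "\<And>T. T \<in> \<T> \<Longrightarrow> continuous_on T (g T)"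
      "\<And>T x. T \<in> \<T> \<Longrightarrow> x \<in> interior T \<Longrightarrow> f x = g T x"
    using f unfolding piecewise_continuous_def by metis
  define N where "N = (\<Union>T\<in>\<T>. frontier T)"
  have N: "negligible N"
    unfolding N_def using fin cell by (intro negligible_Union) auto
  have in_interior: "\<exists>T\<in>\<T>. x \<in> interior T" if "x \<in> \<Omega>" "x \<notin> N" for x
  proof -
    obtain T where "T \<in> \<T>" "x \<in> T" using cover \<open>x \<in> \<Omega>\<close> by blast
    then show ?thesis
      using \<open>x \<notin> N\<close> closure_subset unfolding N_def frontier_def by blast
  qed
  have "(\<lambda>x. indicat_real \<Omega> x *\<^sub>R f x) \<in> borel_measurable lebesgue"
  proof (rule measurable_piecewise_restrict[where C="insert N (insert (- \<Omega>) ((\<lambda>T. \<Omega> \<inter> interior T) ` \<T>))"])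
    fix A assume "A \<in> insert N (insert (- \<Omega>) ((\<lambda>T. \<Omega> \<inter> interior T) ` \<T>))"
    then consider "A = N" | "A = -\<Omega>" | T where "T \<in> \<T>" "A = \<Omega> \<inter> interior T" by auto
    then show "(\<lambda>x. indicat_real \<Omega> x *\<^sub>R f x) \<in> borel_measurable (restrict_space lebesgue A)"
    proof cases
      case 1
      \<comment> \<open>Lebesgue measure is complete, so every function on a null set is measurable.\<close>
      show ?thesis
      proof (rule measurableI)
        fix B :: "'b set"
        have "negligible ((\<lambda>x. indicat_real \<Omega> x *\<^sub>R f x) -` B \<inter> N)"
          using N by (rule negligible_subset) auto
        then have "(\<lambda>x. indicat_real \<Omega> x *\<^sub>R f x) -` B \<inter> N \<in> sets lebesgue"
          by (rule negligible_imp_sets)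
        then show "(\<lambda>x. indicat_real \<Omega> x *\<^sub>R f x) -` B \<inter> space (restrict_space lebesgue A)
            \<in> sets (restrict_space lebesgue A)"
          using 1 N by (subst sets_restrict_space_iff)
            (auto simp: space_restrict_space negligible_imp_sets)
      qed auto
    next
      case 2
      have "(\<lambda>x. 0) \<in> borel_measurable (restrict_space lebesgue A)" by simp
      then show ?thesis
        by (rule measurable_cong[THEN iffD1, rotated]) (auto simp: 2 space_restrict_space)
    next
      case 3
      have "continuous_on A (g T)"
        using g(1)[OF 3(1)] 3 interior_subset by (metis continuous_on_subset inf.coboundedI2)
      then have "g T \<in> borel_measurable (restrict_space lebesgue A)"
        using 3 opn by (intro continuous_imp_measurable_on_sets_lebesgue) auto
      then show ?thesis
        by (rule measurable_cong[THEN iffD1, rotated]) (auto simp: 3 g(2)[OF 3(1)] space_restrict_space)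
    qed
  next
    fix A assume "A \<in> insert N (insert (- \<Omega>) ((\<lambda>T. \<Omega> \<inter> interior T) ` \<T>))"
    then show "A \<inter> space lebesgue \<in> sets lebesgue"
      using opn N by (auto intro: negligible_imp_sets)
  next
    show "space lebesgue \<subseteq> \<Union>(insert N (insert (- \<Omega>) ((\<lambda>T. \<Omega> \<inter> interior T) ` \<T>)))"
      using in_interior by auto
  qed (use fin in \<open>auto intro: countable_finite\<close>)
  moreover have "\<exists>M. \<forall>T\<in>\<T>. \<forall>x\<in>T. norm (g T x) \<le> M"
  proof -
    have "bounded (\<Union>T\<in>\<T>. g T ` T)"
      using fin cell g(1) by (auto intro!: bounded_UN compact_imp_bounded compact_continuous_image)
    then show ?thesis by (auto simp: bounded_iff)
  qed
  then obtain M where M: "\<And>T x. T \<in> \<T> \<Longrightarrow> x \<in> T \<Longrightarrow> norm (g T x) \<le> M" by blast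
  have "AE x in lebesgue. x \<in> \<Omega> \<longrightarrow> norm (f x) \<le> M"
  proof (rule AE_I')
    show "N \<in> null_sets lebesgue" using N by (simp add: negligible_iff_null_sets)
    show "{x \<in> space lebesgue. \<not> (x \<in> \<Omega> \<longrightarrow> norm (f x) \<le> M)} \<subseteq> N"
      using in_interior g(2) M interior_subset by fastforce
  qed
  ultimately show ?thesis
    unfolding bounded_measurable_on_def set_borel_measurable_def by blast
qed

lemma piecewise_continuous_P0: "f \<in> P0_space \<T> \<Longrightarrow> piecewise_continuous \<T> f"
  unfolding P0_space_def piecewise_continuous_def by (fastforce intro: continuous_on_const)


section \<open>Continuously differentiable functions up to the boundary of a cell\<close>

text \<open>
  The derivative is only required in the interior, but has to extend continuously to all of
  \<open>T\<close>. On a compact cell this makes it bounded, which is what the estimates need.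
\<close>

definition C1_up_to_boundary :: "(real^'n) set \<Rightarrow> (real^'n \<Rightarrow> real) \<Rightarrow> bool" where
  "C1_up_to_boundary T f \<longleftrightarrow> continuous_on T f \<and>
     (\<exists>D. (\<forall>w. continuous_on T (\<lambda>x. D x w)) \<and> (\<forall>x\<in>interior T. (f has_derivative D x) (at x)))"

lemma C1_up_to_boundaryI:
  assumes "continuous_on T f" "\<And>w. continuous_on T (\<lambda>x. D x w)"
    "\<And>x. x \<in> interior T \<Longrightarrow> (f has_derivative D x) (at x)"
  shows "C1_up_to_boundary T f"
  using assms unfolding C1_up_to_boundary_def by blast

lemma C1_up_to_boundary_cong:
  assumes f: "C1_up_to_boundary T f" and eq: "\<And>x. x \<in> T \<Longrightarrow> g x = f x"
  shows "C1_up_to_boundary T g"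
proof -
  obtain D where D: "continuous_on T f" "\<And>w. continuous_on T (\<lambda>x. D x w)"
    "\<And>x. x \<in> interior T \<Longrightarrow> (f has_derivative D x) (at x)"
    using f unfolding C1_up_to_boundary_def by blast
  show ?thesis
  proof (rule C1_up_to_boundaryI[where D=D])
    show "continuous_on T g" using D(1) eq by (metis continuous_on_cong)
    show "(g has_derivative D x) (at x)" if "x \<in> interior T" for x
      by (rule has_derivative_transform_within_open[OF D(3)[OF that] open_interior that])
         (use eq interior_subset in \<open>metis subsetD\<close>)
  qed (rule D(2))
qed

lemma C1_up_to_boundary_const: "C1_up_to_boundary T (\<lambda>_. c)"
  by (rule C1_up_to_boundaryI[where D="\<lambda>_ _. 0"]) auto

lemma C1_up_to_boundary_component: "C1_up_to_boundary T (\<lambda>x. x $ i)"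
  by (rule C1_up_to_boundaryI[where D="\<lambda>_ w. w $ i"])
     (auto intro!: continuous_intros derivative_eq_intros bounded_linear_imp_has_derivative
        bounded_linear_vec_nth)

lemma C1_up_to_boundary_add:
  assumes "C1_up_to_boundary T f" "C1_up_to_boundary T g"
  shows "C1_up_to_boundary T (\<lambda>x. f x + g x)"
proof -
  obtain D where D: "continuous_on T f" "\<And>w. continuous_on T (\<lambda>x. D x w)"
    "\<And>x. x \<in> interior T \<Longrightarrow> (f has_derivative D x) (at x)"
    using assms(1) unfolding C1_up_to_boundary_def by blast
  obtain E where E: "continuous_on T g" "\<And>w. continuous_on T (\<lambda>x. E x w)"
    "\<And>x. x \<in> interior T \<Longrightarrow> (g has_derivative E x) (at x)"
    using assms(2) unfolding C1_up_to_boundary_def by blast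
  show ?thesis
    by (rule C1_up_to_boundaryI[where D="\<lambda>x w. D x w + E x w"])
       (auto intro!: D E continuous_intros has_derivative_add)
qed

lemma C1_up_to_boundary_mult:
  assumes "C1_up_to_boundary T f" "C1_up_to_boundary T g"
  shows "C1_up_to_boundary T (\<lambda>x. f x * g x)"
proof -
  obtain D where D: "continuous_on T f" "\<And>w. continuous_on T (\<lambda>x. D x w)"
    "\<And>x. x \<in> interior T \<Longrightarrow> (f has_derivative D x) (at x)"
    using assms(1) unfolding C1_up_to_boundary_def by blast
  obtain E where E: "continuous_on T g" "\<And>w. continuous_on T (\<lambda>x. E x w)"
    "\<And>x. x \<in> interior T \<Longrightarrow> (g has_derivative E x) (at x)"
    using assms(2) unfolding C1_up_to_boundary_def by blast
  show ?thesis
    by (rule C1_up_to_boundaryI[where D="\<lambda>x w. f x * E x w + D x w * g x"])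
       (auto intro!: D E continuous_intros has_derivative_mult)
qed

lemma C1_up_to_boundary_sum:
  "(\<And>i. i \<in> I \<Longrightarrow> C1_up_to_boundary T (f i)) \<Longrightarrow> C1_up_to_boundary T (\<lambda>x. \<Sum>i\<in>I. f i x)"
  by (induction I rule: infinite_finite_induct)
     (auto intro: C1_up_to_boundary_const C1_up_to_boundary_add)

lemma C1_up_to_boundary_prod:
  "(\<And>i. i \<in> I \<Longrightarrow> C1_up_to_boundary T (f i)) \<Longrightarrow> C1_up_to_boundary T (\<lambda>x. \<Prod>i\<in>I. f i x)"
  by (induction I rule: infinite_finite_induct)
     (auto intro: C1_up_to_boundary_const C1_up_to_boundary_mult)

lemma C1_up_to_boundary_power:
  "C1_up_to_boundary T f \<Longrightarrow> C1_up_to_boundary T (\<lambda>x. f x ^ k)"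
  by (induction k) (auto intro: C1_up_to_boundary_const C1_up_to_boundary_mult)

lemma C1_up_to_boundary_tensor_poly:
  assumes "q \<in> tensor_polys p"
  shows "C1_up_to_boundary T q"
proof -
  obtain c where "\<And>\<xi>. q \<xi> = (\<Sum>k | \<forall>i. k i \<le> p. c k * (\<Prod>i\<in>UNIV. (\<xi> $ i) ^ k i))"
    using assms unfolding tensor_polys_def by blast
  then have q: "q = (\<lambda>\<xi>. \<Sum>k | \<forall>i. k i \<le> p. c k * (\<Prod>i\<in>UNIV. (\<xi> $ i) ^ k i))" by blast
  show ?thesis
    unfolding q
    by (intro C1_up_to_boundary_sum C1_up_to_boundary_mult C1_up_to_boundary_const
        C1_up_to_boundary_prod C1_up_to_boundary_power C1_up_to_boundary_component)
qed


section \<open>Cells and functions transported by the reference map\<close>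

lemma reference_map_continuous:
  "reference_map \<Phi> T \<Longrightarrow> continuous_on ref_cube \<Phi>"
  unfolding reference_map_def continuous_on_eq_continuous_within
  by (blast intro: has_derivative_continuous)

lemma reference_map_compact: "reference_map \<Phi> T \<Longrightarrow> compact T"
  using compact_continuous_image[OF reference_map_continuous]
  unfolding reference_map_def ref_cube_def by (metis compact_cbox)

text \<open>By invariance of domain the open reference cube is mapped into the interior of the
  cell, so the boundary of the cell is contained in the image of the boundary of the cube. The
  latter is null because differentiable maps preserve null sets.\<close>

lemma reference_map_negligible_frontier:
  assumes \<Phi>: "reference_map \<Phi> (T :: (real^'n) set)"
  shows "negligible (frontier T)"
proof -
  have im: "\<Phi> ` ref_cube = T" and inj: "inj_on \<Phi> ref_cube"
    using \<Phi> by (auto simp: reference_map_def)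
  have sub: "box 0 (1 :: real^'n) \<subseteq> ref_cube" by (simp add: ref_cube_def box_subset_cbox)
  have "open (\<Phi> ` box 0 (1 :: real^'n))"
    using reference_map_continuous[OF \<Phi>] inj sub
    by (intro invariance_of_domain) (auto intro: continuous_on_subset inj_on_subset)
  then have "\<Phi> ` box 0 (1 :: real^'n) \<subseteq> interior T"
    using im sub by (intro interior_maximal) auto
  moreover have "frontier T = T - interior T"
    using reference_map_compact[OF \<Phi>] by (simp add: frontier_def compact_imp_closed closure_closed)
  ultimately have "frontier T \<subseteq> \<Phi> ` (cbox 0 1 - box 0 (1 :: real^'n))"
    using im by (auto simp: ref_cube_def)
  moreover have "negligible (\<Phi> ` (cbox 0 1 - box 0 (1 :: real^'n)))"
  proof (rule negligible_differentiable_image_negligible)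
    have "\<Phi> differentiable_on ref_cube"
      using \<Phi> unfolding reference_map_def differentiable_on_def differentiable_def by blast
    then show "\<Phi> differentiable_on (cbox 0 1 - box 0 (1 :: real^'n))"
      by (rule differentiable_on_subset) (auto simp: ref_cube_def)
  qed (auto intro: negligible_frontier_interval)
  ultimately show ?thesis by (rule negligible_subset[rotated])
qed

text \<open>
  The derivative of the inverse reference map is written with Cramer's rule: a quotient of
  determinants in the entries of the Jacobian \<open>J\<close> is visibly continuous up to the boundary of
  the cube, where \<open>det J\<close> does not vanish either.
\<close>

lemma C1_up_to_boundary_cell_poly:
  fixes \<Phi> :: "real^'n \<Rightarrow> real^'n"
  assumes \<Phi>: "reference_map \<Phi> T" and f: "f \<in> cell_polys p \<Phi>"
  shows "C1_up_to_boundary T f"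
proof -
  have im: "\<Phi> ` ref_cube = T" and inj: "inj_on \<Phi> ref_cube"
    using \<Phi> by (auto simp: reference_map_def)
  obtain J :: "real^'n \<Rightarrow> real^'n^'n" where J: "continuous_on ref_cube J"
    "\<And>\<xi>. \<xi> \<in> ref_cube \<Longrightarrow> (\<Phi> has_derivative (\<lambda>w. J \<xi> *v w)) (at \<xi> within ref_cube)"
    "\<And>\<xi>. \<xi> \<in> ref_cube \<Longrightarrow> det (J \<xi>) \<noteq> 0"
    using \<Phi> unfolding reference_map_def by blast
  obtain q where q: "q \<in> tensor_polys p" "\<And>\<xi>. \<xi> \<in> ref_cube \<Longrightarrow> f (\<Phi> \<xi>) = q \<xi>"
    using f unfolding cell_polys_def by blast
  obtain D where D: "continuous_on UNIV q" "\<And>w. continuous_on UNIV (\<lambda>\<xi>. D \<xi> w)"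
    "\<And>\<xi>. (q has_derivative D \<xi>) (at \<xi>)"
    using C1_up_to_boundary_tensor_poly[OF q(1), of UNIV]
    unfolding C1_up_to_boundary_def by auto
  define g where "g = inv_into ref_cube \<Phi>"
  have g\<Phi>: "g (\<Phi> \<xi>) = \<xi>" if "\<xi> \<in> ref_cube" for \<xi>
    using that inj by (simp add: g_def)
  have g: "g x \<in> ref_cube" "\<Phi> (g x) = x" if "x \<in> T" for x
    using that im by (auto simp: g_def inv_into_into f_inv_into_f)
  have contg: "continuous_on T g"
    using continuous_on_inv[OF reference_map_continuous[OF \<Phi>], of g] im g\<Phi>
    by (simp add: ref_cube_def)
  \<comment> \<open>Invariance of domain again, now for the inverse map: the chain rule needs the full derivative,
    not the one within the cube, of \<open>\<Phi>\<close> at \<open>g x\<close>.\<close>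
  have g_interior: "g x \<in> interior ref_cube" if "x \<in> interior T" for x
  proof -
    have "inj_on g T" using g(2) by (metis inj_onI)
    then have "open (g ` interior T)"
      using contg interior_subset
      by (intro invariance_of_domain) (auto intro: continuous_on_subset inj_on_subset)
    then have "g ` interior T \<subseteq> interior ref_cube"
      using g(1) interior_subset by (intro interior_maximal) auto
    then show ?thesis using that by blast
  qed
  \<comment> \<open>\<open>K \<xi>\<close> is the inverse of \<open>J \<xi>\<close>, by Cramer's rule.\<close>
  define K :: "real^'n \<Rightarrow> real^'n \<Rightarrow> real^'n" where
    "K \<xi> w = (\<chi> k. det (\<chi> i j. if j = k then w $ i else J \<xi> $ i $ j) / det (J \<xi>))" for \<xi> w
  have JK: "J \<xi> *v K \<xi> w = w" if "\<xi> \<in> ref_cube" for \<xi> w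
    using cramer[OF J(3)[OF that], of "K \<xi> w" w] by (simp add: K_def)
  have contK: "continuous_on ref_cube (\<lambda>\<xi>. K \<xi> w)" for w
  proof -
    have entry: "continuous_on ref_cube (\<lambda>\<xi>. J \<xi> $ i $ j)" for i j
      using J(1) by (intro continuous_intros)
    have column: "continuous_on ref_cube (\<lambda>\<xi>. if j = k then w $ i else J \<xi> $ i $ j)" for i j k
      by (cases "j = k") (auto intro: entry)
    show ?thesis
      unfolding K_def det_def
      by (intro continuous_on_vec_lambda continuous_on_divide)
         (use J(3) in \<open>auto simp: det_def intro!: continuous_intros entry column\<close>)
  qed
  \<comment> \<open>Both the base point and the direction of the derivative of \<open>q\<close> vary with \<open>x\<close>. By linearity
    only the finitely many coordinate directions matter, which are fixed.\<close>
  have lin: "D \<xi> w = (\<Sum>i\<in>UNIV. w $ i * D \<xi> (axis i 1))" for \<xi> w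
  proof -
    have "linear (D \<xi>)" using D(3) by (rule has_derivative_linear)
    then have "D \<xi> (\<Sum>i\<in>UNIV. w $ i *s axis i 1) = (\<Sum>i\<in>UNIV. w $ i * D \<xi> (axis i 1))"
      by (simp add: linear_sum linear_cmul scalar_mult_eq_scaleR)
    then show ?thesis by (simp add: basis_expansion)
  qed
  have fq: "f x = q (g x)" if "x \<in> T" for x
    using g[OF that] q(2)[of "g x"] by simp
  have "C1_up_to_boundary T (\<lambda>x. q (g x))"
  proof (rule C1_up_to_boundaryI[where D="\<lambda>x w. D (g x) (K (g x) w)"])
    show "continuous_on T (\<lambda>x. q (g x))"
      by (rule continuous_on_compose2[OF D(1) contg]) auto
    show "continuous_on T (\<lambda>x. D (g x) (K (g x) w))" for w
    proof -
      have "continuous_on T (\<lambda>x. K (g x) w)"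
        by (rule continuous_on_compose2[OF contK contg]) (use g in auto)
      moreover have "continuous_on T (\<lambda>x. D (g x) v)" for v
        by (rule continuous_on_compose2[OF D(2) contg]) auto
      ultimately show ?thesis
        unfolding lin[of _ "K _ w"] by (intro continuous_intros)
    qed
    fix x assume x: "x \<in> interior T"
    then have xT: "x \<in> T" using interior_subset by blast
    have "(\<Phi> has_derivative (\<lambda>w. J (g x) *v w)) (at (g x))"
      using J(2)[OF g(1)[OF xT]] unfolding at_within_interior[OF g_interior[OF x]] .
    then have "(g has_derivative K (g x)) (at x)"
    proof (rule has_derivative_inverse_strong_x[rotated 4])
      show "(\<lambda>w. J (g x) *v w) \<circ> K (g x) = id"
        using JK[OF g(1)[OF xT]] by (simp add: fun_eq_iff)
      show "open (interior (ref_cube :: (real^'n) set))" by simp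
      show "continuous_on (interior ref_cube) \<Phi>"
        using reference_map_continuous[OF \<Phi>] interior_subset by (rule continuous_on_subset)
      show "g (\<Phi> \<xi>) = \<xi>" if "\<xi> \<in> interior ref_cube" for \<xi>
        using that interior_subset g\<Phi> by blast
    qed (fact g_interior[OF x] g(2)[OF xT])+
    then show "((\<lambda>x. q (g x)) has_derivative (\<lambda>w. D (g x) (K (g x) w))) (at x)"
      using D(3) by (rule has_derivative_compose)
  qed
  then show ?thesis by (rule C1_up_to_boundary_cong) (simp add: fq)
qed


section \<open>Finite element fields and their derivatives\<close>

definition piecewise_C1_field :: "(real^'n) set set \<Rightarrow> (real^'n \<Rightarrow> real^3) \<Rightarrow> bool" where
  "piecewise_C1_field \<T> v \<longleftrightarrow> (\<forall>T\<in>\<T>. \<forall>i. C1_up_to_boundary T (\<lambda>x. v x $ i))"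

lemma piecewise_C1_field_Q_vec_space:
  assumes "v \<in> Q_vec_space \<Omega> \<T> F p" "\<And>T. T \<in> \<T> \<Longrightarrow> reference_map (F T) T"
  shows "piecewise_C1_field \<T> v"
  using assms unfolding piecewise_C1_field_def Q_vec_space_def Q_space_def
  by (blast intro: C1_up_to_boundary_cell_poly)

lemma piecewise_C1_field_V_space:
  assumes v: "v \<in> V_space \<Omega> \<T> F b m n" and n: "n \<in> Q_vec_space \<Omega> \<T> F p"
    and ref: "\<And>T. T \<in> \<T> \<Longrightarrow> reference_map (F T) T"
    and b: "\<And>T. T \<in> \<T> \<Longrightarrow> quadratic_bubble T (F T) (b T)"
  shows "piecewise_C1_field \<T> v"
  unfolding piecewise_C1_field_def
proof (intro ballI allI)
  fix T i assume T: "T \<in> \<T>"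
  obtain w z where w: "w \<in> Q_vec_space \<Omega> \<T> F m" and z: "z \<in> bubble_space \<Omega> \<T> b n"
    and v: "v = (\<lambda>x. w x + z x)"
    using v unfolding V_space_def by blast
  obtain a where a: "\<And>x. x \<in> T \<Longrightarrow> z x = (a * b T x) *\<^sub>R n x"
    using z T unfolding bubble_space_def by blast
  have "C1_up_to_boundary T (b T)"
    using b[OF T] ref[OF T] unfolding quadratic_bubble_def
    by (blast intro: C1_up_to_boundary_cell_poly)
  then have "C1_up_to_boundary T (\<lambda>x. w x $ i + a * b T x * n x $ i)"
    using piecewise_C1_field_Q_vec_space[OF w ref] piecewise_C1_field_Q_vec_space[OF n ref] T
    unfolding piecewise_C1_field_def
    by (intro C1_up_to_boundary_add C1_up_to_boundary_mult C1_up_to_boundary_const) auto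
  then show "C1_up_to_boundary T (\<lambda>x. v x $ i)"
    by (rule C1_up_to_boundary_cong) (simp add: v a)
qed

lemma partial_deriv_continuous_extension:
  assumes f: "C1_up_to_boundary T f"
  obtains g where "continuous_on T g" "\<And>x. x \<in> interior T \<Longrightarrow> partial_deriv e j f x = g x"
proof -
  obtain D where D: "\<And>w. continuous_on T (\<lambda>x. D x w)"
    "\<And>x. x \<in> interior T \<Longrightarrow> (f has_derivative D x) (at x)"
    using f unfolding C1_up_to_boundary_def by blast
  show thesis
  proof (rule that[of "\<lambda>x. if j \<in> range e then D x (axis (inv e j) 1) else 0"])
    show "continuous_on T (\<lambda>x. if j \<in> range e then D x (axis (inv e j) 1) else 0)"
      by (cases "j \<in> range e") (simp_all add: D(1))
    show "partial_deriv e j f x = (if j \<in> range e then D x (axis (inv e j) 1) else 0)"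
      if "x \<in> interior T" for x
      using frechet_derivative_at[OF D(2)[OF that]] by (simp add: partial_deriv_def)
  qed
qed

lemma piecewise_continuous_field:
  assumes "piecewise_C1_field \<T> v"
  shows "piecewise_continuous \<T> v"
  unfolding piecewise_continuous_def
proof
  fix T assume "T \<in> \<T>"
  then have "\<And>i. continuous_on T (\<lambda>x. v x $ i)"
    using assms unfolding piecewise_C1_field_def C1_up_to_boundary_def by blast
  then have "continuous_on T (\<lambda>x. \<chi> i. v x $ i)" by (rule continuous_on_vec_lambda)
  then show "\<exists>g. continuous_on T g \<and> (\<forall>x\<in>interior T. v x = g x)" by auto
qed

lemma piecewise_continuous_divergence_curl:
  assumes v: "piecewise_C1_field \<T> v"
  shows "piecewise_continuous \<T> (divergence e v)" "piecewise_continuous \<T> (curl e v)"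
proof -
  have "\<exists>G. (\<forall>i j. continuous_on T (G i j)) \<and>
      (\<forall>i j. \<forall>x\<in>interior T. partial_deriv e j (\<lambda>y. v y $ i) x = G i j x)" if "T \<in> \<T>" for T
  proof -
    have "\<forall>i j. \<exists>g. continuous_on T g \<and>
        (\<forall>x\<in>interior T. partial_deriv e j (\<lambda>y. v y $ i) x = g x)"
      using v that unfolding piecewise_C1_field_def
      by (metis partial_deriv_continuous_extension)
    then show ?thesis by metis
  qed
  then obtain G where G: "\<And>T i j. T \<in> \<T> \<Longrightarrow> continuous_on T (G T i j)"
    "\<And>T i j x. T \<in> \<T> \<Longrightarrow> x \<in> interior T \<Longrightarrow> partial_deriv e j (\<lambda>y. v y $ i) x = G T i j x"
    by metis
  show "piecewise_continuous \<T> (divergence e v)"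
    unfolding piecewise_continuous_def
  proof
    fix T assume T: "T \<in> \<T>"
    have "continuous_on T (\<lambda>x. \<Sum>j\<in>UNIV. G T j j x)"
      using G(1)[OF T] by (intro continuous_intros)
    moreover have "divergence e v x = (\<Sum>j\<in>UNIV. G T j j x)" if "x \<in> interior T" for x
      using G(2)[OF T that] by (simp add: divergence_def)
    ultimately show "\<exists>g. continuous_on T g \<and> (\<forall>x\<in>interior T. divergence e v x = g x)" by blast
  qed
  show "piecewise_continuous \<T> (curl e v)"
    unfolding piecewise_continuous_def
  proof
    fix T assume T: "T \<in> \<T>"
    have vec: "vector [a, b, c] = a *\<^sub>R axis 1 1 + b *\<^sub>R axis 2 1 + c *\<^sub>R (axis 3 1 :: real^3)"
      for a b c :: real
      by (simp add: vec_eq_iff forall_3 axis_def)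
    let ?g = "\<lambda>x. vector [G T 3 2 x - G T 2 3 x, G T 1 3 x - G T 3 1 x, G T 2 1 x - G T 1 2 x] :: real^3"
    have "continuous_on T ?g"
      unfolding vec using G(1)[OF T] by (intro continuous_intros)
    moreover have "curl e v x = ?g x" if "x \<in> interior T" for x
      using G(2)[OF T that] by (simp add: curl_def)
    ultimately show "\<exists>g. continuous_on T g \<and> (\<forall>x\<in>interior T. curl e v x = g x)" by blast
  qed
qed

lemma quad_subdivision_bounded_measurable_on:
  fixes f :: "real^'n \<Rightarrow> 'b::euclidean_space"
  assumes \<T>: "quad_subdivision \<Omega> \<T> F" and \<Omega>: "open \<Omega>" and f: "piecewise_continuous \<T> f"
  shows "bounded_measurable_on \<Omega> f"
proof (rule piecewise_continuous_imp_bounded_measurable_on[OF _ _ \<Omega> _ _ f])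
  show "\<Omega> \<subseteq> \<Union>\<T>" using \<T> closure_subset unfolding quad_subdivision_def by blast
qed (use \<T> in \<open>auto simp: quad_subdivision_def
       intro: reference_map_compact reference_map_negligible_frontier\<close>)


section \<open>Continuity of the forms\<close>

lemma norm_Z_tensor_le:
  assumes "(norm n)\<^sup>2 \<le> \<beta>"
  shows "norm (Z_tensor \<kappa> n *v \<xi>) \<le> (1 + \<bar>1 - \<kappa>\<bar> * \<beta>) * norm \<xi>"
proof -
  have "Z_tensor \<kappa> n *v \<xi> = \<xi> - ((1 - \<kappa>) * (n \<bullet> \<xi>)) *\<^sub>R n"
    by (simp add: Z_tensor_def vec_eq_iff matrix_vector_mult_def inner_vec_def mat_def sum_3
        forall_3 algebra_simps)
  also have "norm \<dots> \<le> norm \<xi> + \<bar>1 - \<kappa>\<bar> * (\<bar>n \<bullet> \<xi>\<bar> * norm n)"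
    by (rule order_trans[OF norm_triangle_ineq4]) (simp add: abs_mult mult.assoc)
  also have "\<dots> \<le> norm \<xi> + \<bar>1 - \<kappa>\<bar> * (\<beta> * norm \<xi>)"
  proof -
    have "\<bar>n \<bullet> \<xi>\<bar> * norm n \<le> norm n * norm \<xi> * norm n"
      by (intro mult_right_mono Cauchy_Schwarz_ineq2) auto
    also have "\<dots> = (norm n)\<^sup>2 * norm \<xi>" by (simp add: power2_eq_square)
    also have "\<dots> \<le> \<beta> * norm \<xi>" using assms by (intro mult_right_mono) auto
    finally show ?thesis by (intro add_left_mono mult_left_mono) auto
  qed
  finally show ?thesis by (simp add: algebra_simps)
qed

lemma abs_mult_inner_le:
  fixes a b :: "'a::real_inner" and c d :: "'b::real_inner"
  shows "\<bar>(a \<bullet> b) * (c \<bullet> d)\<bar> \<le> (norm a * norm b) * (norm c * norm d)"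
  unfolding abs_mult by (intro mult_mono Cauchy_Schwarz_ineq2) auto

text \<open>
  The constant does not depend on the mesh to which \<open>u\<close> and \<open>v\<close> belong. The previous
  iterate enters only through bounds for \<open>n\<close>, \<open>curl e n\<close> and the multiplier.
\<close>

lemma abs_form_a_le:
  fixes n u v :: "real^'n::finite \<Rightarrow> real^3"
  assumes \<Omega>: "\<Omega> \<in> lmeasurable"
    and K: "K1 \<ge> 0" "K3 \<ge> 0"
    and n: "\<And>x. x \<in> \<Omega> \<Longrightarrow> (norm (n x))\<^sup>2 \<le> \<beta>"
    and M: "0 \<le> M" "AE x in lebesgue. x \<in> \<Omega> \<longrightarrow> norm (curl e n x) \<le> M"
    and L: "0 \<le> L" "AE x in lebesgue. x \<in> \<Omega> \<longrightarrow> \<bar>lam x\<bar> \<le> L"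
    and \<beta>: "0 \<le> \<beta>"
    and u: "bounded_measurable_on \<Omega> u" "bounded_measurable_on \<Omega> (divergence e u)"
      "bounded_measurable_on \<Omega> (curl e u)"
    and v: "bounded_measurable_on \<Omega> v" "bounded_measurable_on \<Omega> (divergence e v)"
      "bounded_measurable_on \<Omega> (curl e v)"
  shows "\<bar>form_a e \<Omega> K1 K2 K3 n lam u v\<bar> \<le>
    (K1 + K3 * (1 + \<bar>1 - K2 / K3\<bar> * \<beta>) + \<bar>K2 - K3\<bar> * (4 * (sqrt \<beta> * M) + M\<^sup>2) + L) *
      (DC_norm e \<Omega> u * DC_norm e \<Omega> v)"
proof -
  let ?P = "DC_norm e \<Omega> u * DC_norm e \<Omega> v"
  let ?s = "sqrt \<beta>"
  have bound: "\<bar>LINT x:\<Omega>|lebesgue. h x\<bar> \<le> c * ?P"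
    if "bounded_measurable_on \<Omega> f" "bounded_measurable_on \<Omega> g" "0 \<le> c"
      "L2_norm \<Omega> f \<le> DC_norm e \<Omega> u" "L2_norm \<Omega> g \<le> DC_norm e \<Omega> v"
      "AE x in lebesgue. x \<in> \<Omega> \<longrightarrow> \<bar>h x\<bar> \<le> c * (norm (f x) * norm (g x))"
    for h :: "real^'n \<Rightarrow> real" and c and f :: "real^'n \<Rightarrow> 'x::euclidean_space"
      and g :: "real^'n \<Rightarrow> 'y::euclidean_space"
  proof -
    have "\<bar>LINT x:\<Omega>|lebesgue. h x\<bar> \<le> c * (L2_norm \<Omega> f * L2_norm \<Omega> g)"
      using abs_set_integral_le_L2_norms[OF \<Omega>] that by blast
    also have "\<dots> \<le> c * ?P"
      using that by (intro mult_left_mono mult_mono order_trans[OF L2_norm_nonneg that(4)]) auto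
    finally show ?thesis .
  qed
  have n': "norm (n x) \<le> ?s" if "x \<in> \<Omega>" for x
    using n[OF that] by (rule real_le_rsqrt)
  have nM: "norm (n x) * norm (curl e n x) \<le> ?s * M"
    if "x \<in> \<Omega>" "norm (curl e n x) \<le> M" for x
    using n'[OF that(1)] that(2) \<beta> by (intro mult_mono) auto
  have sM: "0 \<le> ?s * M" using M \<beta> by simp
  note DC = L2_norm_le_DC_norm
  have i1: "\<bar>L2_inner \<Omega> (divergence e u) (divergence e v)\<bar> \<le> 1 * ?P"
    unfolding L2_inner_def
    by (rule bound[OF u(2) v(2) _ DC(2) DC(2)]) (auto simp: abs_mult)
  have i2: "\<bar>L2_inner \<Omega> (\<lambda>x. Z_tensor (K2 / K3) (n x) *v curl e u x) (curl e v)\<bar>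
      \<le> (1 + \<bar>1 - K2 / K3\<bar> * \<beta>) * ?P"
    unfolding L2_inner_def
  proof (rule bound[OF u(3) v(3) _ DC(3) DC(3)])
    show "0 \<le> 1 + \<bar>1 - K2 / K3\<bar> * \<beta>" using \<beta> by simp
    have "\<bar>(Z_tensor (K2 / K3) (n x) *v curl e u x) \<bullet> curl e v x\<bar>
        \<le> (1 + \<bar>1 - K2 / K3\<bar> * \<beta>) * (norm (curl e u x) * norm (curl e v x))" if "x \<in> \<Omega>" for x
      unfolding mult.assoc[symmetric]
      by (intro order_trans[OF Cauchy_Schwarz_ineq2] mult_right_mono norm_Z_tensor_le[OF n[OF that]]
          norm_ge_zero)
    then show "AE x in lebesgue. x \<in> \<Omega> \<longrightarrow>
        \<bar>(Z_tensor (K2 / K3) (n x) *v curl e u x) \<bullet> curl e v x\<bar>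
        \<le> (1 + \<bar>1 - K2 / K3\<bar> * \<beta>) * (norm (curl e u x) * norm (curl e v x))" by simp
  qed
  have i3: "\<bar>L2_inner \<Omega> (\<lambda>x. u x \<bullet> curl e v x) (\<lambda>x. n x \<bullet> curl e n x)\<bar> \<le> (?s * M) * ?P"
    unfolding L2_inner_def inner_real_def
  proof (rule bound[OF u(1) v(3) sM DC(1) DC(3)], use M(2) in eventually_elim, intro impI)
    fix x assume "x \<in> \<Omega> \<longrightarrow> norm (curl e n x) \<le> M" "x \<in> \<Omega>"
    then have "norm (n x) * norm (curl e n x) \<le> ?s * M" by (simp add: nM)
    from mult_left_mono[OF this, of "norm (u x) * norm (curl e v x)"]
    show "\<bar>(u x \<bullet> curl e v x) * (n x \<bullet> curl e n x)\<bar> \<le> ?s * M * (norm (u x) * norm (curl e v x))"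
      using abs_mult_inner_le[of "u x" "curl e v x" "n x" "curl e n x"] by (simp add: mult_ac)
  qed
  have i4: "\<bar>L2_inner \<Omega> (\<lambda>x. n x \<bullet> curl e v x) (\<lambda>x. u x \<bullet> curl e n x)\<bar> \<le> (?s * M) * ?P"
    unfolding L2_inner_def inner_real_def
  proof (rule bound[OF u(1) v(3) sM DC(1) DC(3)], use M(2) in eventually_elim, intro impI)
    fix x assume "x \<in> \<Omega> \<longrightarrow> norm (curl e n x) \<le> M" "x \<in> \<Omega>"
    then have "norm (n x) * norm (curl e n x) \<le> ?s * M" by (simp add: nM)
    from mult_left_mono[OF this, of "norm (u x) * norm (curl e v x)"]
    show "\<bar>(n x \<bullet> curl e v x) * (u x \<bullet> curl e n x)\<bar> \<le> ?s * M * (norm (u x) * norm (curl e v x))"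
      using abs_mult_inner_le[of "n x" "curl e v x" "u x" "curl e n x"] by (simp add: mult_ac)
  qed
  have i5: "\<bar>L2_inner \<Omega> (\<lambda>x. n x \<bullet> curl e n x) (\<lambda>x. v x \<bullet> curl e u x)\<bar> \<le> (?s * M) * ?P"
    unfolding L2_inner_def inner_real_def
  proof (rule bound[OF u(3) v(1) sM DC(3) DC(1)], use M(2) in eventually_elim, intro impI)
    fix x assume "x \<in> \<Omega> \<longrightarrow> norm (curl e n x) \<le> M" "x \<in> \<Omega>"
    then have "norm (n x) * norm (curl e n x) \<le> ?s * M" by (simp add: nM)
    from mult_left_mono[OF this, of "norm (curl e u x) * norm (v x)"]
    show "\<bar>(n x \<bullet> curl e n x) * (v x \<bullet> curl e u x)\<bar> \<le> ?s * M * (norm (curl e u x) * norm (v x))"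
      using abs_mult_inner_le[of "n x" "curl e n x" "v x" "curl e u x"] by (simp add: mult_ac)
  qed
  have i6: "\<bar>L2_inner \<Omega> (\<lambda>x. n x \<bullet> curl e u x) (\<lambda>x. v x \<bullet> curl e n x)\<bar> \<le> (?s * M) * ?P"
    unfolding L2_inner_def inner_real_def
  proof (rule bound[OF u(3) v(1) sM DC(3) DC(1)], use M(2) in eventually_elim, intro impI)
    fix x assume "x \<in> \<Omega> \<longrightarrow> norm (curl e n x) \<le> M" "x \<in> \<Omega>"
    then have "norm (n x) * norm (curl e n x) \<le> ?s * M" by (simp add: nM)
    from mult_left_mono[OF this, of "norm (curl e u x) * norm (v x)"]
    show "\<bar>(n x \<bullet> curl e u x) * (v x \<bullet> curl e n x)\<bar> \<le> ?s * M * (norm (curl e u x) * norm (v x))"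
      using abs_mult_inner_le[of "n x" "curl e u x" "v x" "curl e n x"] by (simp add: mult_ac)
  qed
  have i7: "\<bar>L2_inner \<Omega> (\<lambda>x. u x \<bullet> curl e n x) (\<lambda>x. v x \<bullet> curl e n x)\<bar> \<le> M\<^sup>2 * ?P"
    unfolding L2_inner_def inner_real_def
  proof (rule bound[OF u(1) v(1) _ DC(1) DC(1)], simp, use M(2) in eventually_elim, intro impI)
    fix x assume "x \<in> \<Omega> \<longrightarrow> norm (curl e n x) \<le> M" "x \<in> \<Omega>"
    then have "norm (curl e n x) * norm (curl e n x) \<le> M\<^sup>2"
      unfolding power2_eq_square by (intro mult_mono) (use M in auto)
    from mult_left_mono[OF this, of "norm (u x) * norm (v x)"]
    show "\<bar>(u x \<bullet> curl e n x) * (v x \<bullet> curl e n x)\<bar> \<le> M\<^sup>2 * (norm (u x) * norm (v x))"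
      using abs_mult_inner_le[of "u x" "curl e n x" "v x" "curl e n x"] by (simp add: mult_ac)
  qed
  have i8: "\<bar>LINT x:\<Omega>|lebesgue. lam x * (u x \<bullet> v x)\<bar> \<le> L * ?P"
    by (rule bound[OF u(1) v(1) L(1) DC(1) DC(1)], use L(2) in eventually_elim)
       (auto simp: abs_mult intro!: mult_mono Cauchy_Schwarz_ineq2 L(1))
  have tri: "\<bar>K1 * a1 + K3 * a2 + d * (a3 + a4 + a5 + a6 + a7) + a8\<bar>
      \<le> (K1 + K3 * z + \<bar>d\<bar> * (4 * s + m) + l) * p"
    if "\<bar>a1\<bar> \<le> 1 * p" "\<bar>a2\<bar> \<le> z * p" "\<bar>a3\<bar> \<le> s * p" "\<bar>a4\<bar> \<le> s * p" "\<bar>a5\<bar> \<le> s * p" "\<bar>a6\<bar> \<le> s * p"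
      "\<bar>a7\<bar> \<le> m * p" "\<bar>a8\<bar> \<le> l * p"
    for a1 a2 a3 a4 a5 a6 a7 a8 d z s m l p :: real
  proof -
    have "\<bar>K1 * a1\<bar> \<le> K1 * p" "\<bar>K3 * a2\<bar> \<le> K3 * (z * p)"
      using that K by (auto simp: abs_mult intro!: mult_left_mono)
    moreover have "\<bar>d * (a3 + a4 + a5 + a6 + a7)\<bar> \<le> \<bar>d\<bar> * (4 * (s * p) + m * p)"
      unfolding abs_mult using that by (intro mult_left_mono) auto
    ultimately have "\<bar>K1 * a1 + K3 * a2 + d * (a3 + a4 + a5 + a6 + a7) + a8\<bar>
        \<le> K1 * p + K3 * (z * p) + \<bar>d\<bar> * (4 * (s * p) + m * p) + l * p"
      using that(8) by linarith
    then show ?thesis by (simp add: algebra_simps)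
  qed
  show ?thesis
    unfolding form_a_def by (rule tri[OF i1 i2 i3 i4 i5 i6 i7 i8])
qed

lemma abs_form_b_le:
  fixes n v :: "real^'n::finite \<Rightarrow> real^3"
  assumes \<Omega>: "\<Omega> \<in> lmeasurable"
    and n: "\<And>x. x \<in> \<Omega> \<Longrightarrow> (norm (n x))\<^sup>2 \<le> \<beta>" and \<beta>: "0 \<le> \<beta>"
    and v: "bounded_measurable_on \<Omega> v" and \<gamma>: "bounded_measurable_on \<Omega> \<gamma>"
  shows "\<bar>form_b \<Omega> n v \<gamma>\<bar> \<le> sqrt \<beta> * (DC_norm e \<Omega> v * L2_norm \<Omega> \<gamma>)"
proof -
  have "\<bar>\<gamma> x * (n x \<bullet> v x)\<bar> \<le> sqrt \<beta> * (norm (v x) * norm (\<gamma> x))" if "x \<in> \<Omega>" for x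
  proof -
    have "\<bar>n x \<bullet> v x\<bar> \<le> sqrt \<beta> * norm (v x)"
      by (rule order_trans[OF Cauchy_Schwarz_ineq2])
         (intro mult_right_mono real_le_rsqrt n[OF that] norm_ge_zero)
    from mult_left_mono[OF this, of "\<bar>\<gamma> x\<bar>"] show ?thesis by (simp add: abs_mult mult_ac)
  qed
  then have "\<bar>form_b \<Omega> n v \<gamma>\<bar> \<le> sqrt \<beta> * (L2_norm \<Omega> v * L2_norm \<Omega> \<gamma>)"
    unfolding form_b_def using \<beta> by (intro abs_set_integral_le_L2_norms[OF \<Omega> v \<gamma>]) auto
  also have "\<dots> \<le> sqrt \<beta> * (DC_norm e \<Omega> v * L2_norm \<Omega> \<gamma>)"
    using \<beta> by (intro mult_left_mono mult_right_mono L2_norm_le_DC_norm) auto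
  finally show ?thesis .
qed

theorem lemma3p6:
  fixes e :: "'n::finite \<Rightarrow> 3"
    and \<Omega> :: "(real^'n) set"
    and \<T> :: "real \<Rightarrow> (real^'n) set set"
    and F :: "real \<Rightarrow> (real^'n) set \<Rightarrow> real^'n \<Rightarrow> real^'n"
    and b :: "real \<Rightarrow> (real^'n) set \<Rightarrow> real^'n \<Rightarrow> real"
    and n :: "real^'n \<Rightarrow> real^3"
    and lam :: "real^'n \<Rightarrow> real"
    and K1 K2 K3 \<alpha> \<beta> \<eta> \<Lambda> :: real
    and p m :: nat
  assumes dimension: "inj e" "range e = {1, 2} \<or> range e = {1, 2, 3}"
    and domain: "admissible_domain \<Omega>"
    and mesh: "quasi_uniform_family \<Omega> \<T> F"
    and bubbles: "\<And>h T. h \<in> {0<..1} \<Longrightarrow> T \<in> \<T> h \<Longrightarrow> quadratic_bubble T (F h T) (b h T)"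
    and degrees: "p \<ge> 1" "m \<ge> 1"
    and constants: "K1 \<ge> 0" "K2 > 0" "K3 > 0"
    and director_bounds: "0 < \<alpha>" "\<alpha> \<le> 1" "1 \<le> \<beta>"
      "\<And>x. x \<in> \<Omega> \<Longrightarrow> \<alpha> \<le> (norm (n x))\<^sup>2 \<and> (norm (n x))\<^sup>2 \<le> \<beta>"
    and Z_uniformly_spd: "0 < \<eta>" "\<eta> \<le> \<Lambda>"
      "\<And>x \<xi>. x \<in> \<Omega> \<Longrightarrow>
         \<eta> * (norm \<xi>)\<^sup>2 \<le> \<xi> \<bullet> (Z_tensor (K2 / K3) (n x) *v \<xi>) \<and>
         \<xi> \<bullet> (Z_tensor (K2 / K3) (n x) *v \<xi>) \<le> \<Lambda> * (norm \<xi>)\<^sup>2"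
  shows "\<exists>C\<^sub>A>0. \<exists>C\<^sub>B>0. \<forall>h\<in>{0<..1}.
      n \<in> Q_vec_space \<Omega> (\<T> h) (F h) p \<and> lam \<in> P0_space (\<T> h) \<longrightarrow>
        (\<forall>u \<in> V_space \<Omega> (\<T> h) (F h) (b h) m n. \<forall>v \<in> V_space \<Omega> (\<T> h) (F h) (b h) m n.
           \<bar>form_a e \<Omega> K1 K2 K3 n lam u v\<bar> \<le> C\<^sub>A * DC_norm e \<Omega> u * DC_norm e \<Omega> v) \<and>
        (\<forall>v \<in> V_space \<Omega> (\<T> h) (F h) (b h) m n. \<forall>\<gamma> \<in> P0_space (\<T> h).
           \<bar>form_b \<Omega> n v \<gamma>\<bar> \<le> C\<^sub>B * DC_norm e \<Omega> v * L2_norm \<Omega> \<gamma>)"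
proof (cases "\<exists>h\<in>{0<..1}. n \<in> Q_vec_space \<Omega> (\<T> h) (F h) p \<and> lam \<in> P0_space (\<T> h)")
  case False
  then show ?thesis by (intro exI[of _ 1] conjI) auto
next
  case True
  \<comment> \<open>The pair \<open>(n, lam)\<close> is given independently of the mesh size, so its bounds may be read off
    on one mesh to which it belongs, and they then serve for all other meshes.\<close>
  then obtain h0 where h0: "h0 \<in> {0<..1}" "n \<in> Q_vec_space \<Omega> (\<T> h0) (F h0) p"
    "lam \<in> P0_space (\<T> h0)" by blast
  have opn: "open \<Omega>" and "bounded \<Omega>" using domain by (auto simp: admissible_domain_def)
  then have \<Omega>: "\<Omega> \<in> lmeasurable" by (simp add: lmeasurable_open)
  have sub: "quad_subdivision \<Omega> (\<T> h) (F h)" if "h \<in> {0<..1}" for h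
    using mesh that by (auto simp: quasi_uniform_family_def)
  then have ref: "reference_map (F h T) T" if "h \<in> {0<..1}" "T \<in> \<T> h" for h T
    using that by (auto simp: quad_subdivision_def)
  note bm = quad_subdivision_bounded_measurable_on[OF sub opn]

  have "bounded_measurable_on \<Omega> (curl e n)"
    using h0 ref by (intro bm[OF h0(1)] piecewise_continuous_divergence_curl
        piecewise_C1_field_Q_vec_space[OF h0(2)]) auto
  then obtain M where M: "AE x in lebesgue. x \<in> \<Omega> \<longrightarrow> norm (curl e n x) \<le> M"
    by (auto simp: bounded_measurable_on_def)
  have "bounded_measurable_on \<Omega> lam"
    by (intro bm[OF h0(1)] piecewise_continuous_P0 h0)
  then obtain L where L: "AE x in lebesgue. x \<in> \<Omega> \<longrightarrow> \<bar>lam x\<bar> \<le> L"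
    by (auto simp: bounded_measurable_on_def)
  define M' where "M' = max 0 M"
  define L' where "L' = max 0 L"
  have M': "0 \<le> M'" "AE x in lebesgue. x \<in> \<Omega> \<longrightarrow> norm (curl e n x) \<le> M'"
    using M by (auto simp: M'_def elim!: eventually_mono)
  have L': "0 \<le> L'" "AE x in lebesgue. x \<in> \<Omega> \<longrightarrow> \<bar>lam x\<bar> \<le> L'"
    using L by (auto simp: L'_def elim!: eventually_mono)
  have \<beta>: "0 \<le> \<beta>" and K: "K1 \<ge> 0" "K3 \<ge> 0" using director_bounds(3) constants by auto
  have n\<beta>: "(norm (n x))\<^sup>2 \<le> \<beta>" if "x \<in> \<Omega>" for x using director_bounds(4) that by blast
  define C where "C = K1 + K3 * (1 + \<bar>1 - K2 / K3\<bar> * \<beta>)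
      + \<bar>K2 - K3\<bar> * (4 * (sqrt \<beta> * M') + M'\<^sup>2) + L'"
  have "C > 0"
  proof -
    have "K3 * (1 + \<bar>1 - K2 / K3\<bar> * \<beta>) > 0"
      using constants \<beta> by (intro mult_pos_pos add_pos_nonneg) auto
    moreover have "\<bar>K2 - K3\<bar> * (4 * (sqrt \<beta> * M') + M'\<^sup>2) \<ge> 0" using M' \<beta> by simp
    ultimately show ?thesis using K L' unfolding C_def by linarith
  qed
  have V: "bounded_measurable_on \<Omega> v" "bounded_measurable_on \<Omega> (divergence e v)"
    "bounded_measurable_on \<Omega> (curl e v)"
    if h: "h \<in> {0<..1}" and "n \<in> Q_vec_space \<Omega> (\<T> h) (F h) p"
      and "v \<in> V_space \<Omega> (\<T> h) (F h) (b h) m n" for h v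
  proof -
    have "piecewise_C1_field (\<T> h) v"
      using piecewise_C1_field_V_space[OF that(3,2)] ref[OF h] bubbles[OF h] by blast
    then show "bounded_measurable_on \<Omega> v" "bounded_measurable_on \<Omega> (divergence e v)"
      "bounded_measurable_on \<Omega> (curl e v)"
      by (auto intro: bm[OF h] piecewise_continuous_field piecewise_continuous_divergence_curl)
  qed
  show ?thesis
  proof (rule exI[of _ C], intro exI[of _ "sqrt \<beta>"] conjI ballI impI)
    show "C > 0" by fact
    show "sqrt \<beta> > 0" using director_bounds(3) by simp
  next
    fix h u v
    assume "h \<in> {0<..1}" "n \<in> Q_vec_space \<Omega> (\<T> h) (F h) p \<and> lam \<in> P0_space (\<T> h)"
      "u \<in> V_space \<Omega> (\<T> h) (F h) (b h) m n" "v \<in> V_space \<Omega> (\<T> h) (F h) (b h) m n"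
    then show "\<bar>form_a e \<Omega> K1 K2 K3 n lam u v\<bar> \<le> C * DC_norm e \<Omega> u * DC_norm e \<Omega> v"
      unfolding C_def mult.assoc[of _ "DC_norm e \<Omega> u"]
      by (intro abs_form_a_le[OF \<Omega> K n\<beta> M' L' \<beta>] V) auto
  next
    fix h v \<gamma>
    assume h: "h \<in> {0<..1}" "n \<in> Q_vec_space \<Omega> (\<T> h) (F h) p \<and> lam \<in> P0_space (\<T> h)"
      "v \<in> V_space \<Omega> (\<T> h) (F h) (b h) m n" "\<gamma> \<in> P0_space (\<T> h)"
    then have "bounded_measurable_on \<Omega> v" "bounded_measurable_on \<Omega> \<gamma>"
      using V bm[OF h(1) piecewise_continuous_P0] by blast+
    then show "\<bar>form_b \<Omega> n v \<gamma>\<bar> \<le> sqrt \<beta> * DC_norm e \<Omega> v * L2_norm \<Omega> \<gamma>"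
      unfolding mult.assoc[of _ "DC_norm e \<Omega> v"]
      by (intro abs_form_b_le[OF \<Omega> n\<beta> \<beta>]) auto
  qed
qed

end
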